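(* Let $X\subseteq\mathbb U$ be closed and Heine-Borel (with the induced metric), and let $M>0$. Then $\{z\in\mathbb U\colon d(z,X)\ge M\}$ (with the induced metric) is isometric to $\mathbb U$.
   Context: $\mathbb U$ (with distance $d$) denotes the Urysohn space: the unique (up to isometry) nonempty complete separable metric space that is finitely injective, i.e. for any finite metric spaces $K\subseteq L$ and any isometric embedding $\varphi\colon K\to\mathbb U$ there is an isometric embedding $\tilde\varphi\colon L\to\mathbb U$ extending $\varphi$. A complete separable metric space $X$ is Heine-Borel if closed bounded balls in $X$ are compact. $d(z,X)=\inf_{x\in X}d(z,x)$ (with $\inf\emptyset=+\infty$). *)

theory Defs
  imports "HOL-Analysis.Analysis"
begin

definition isometric_embedding :: "'a metric \<Rightarrow> 'b metric \<Rightarrow> ('a \<Rightarrow> 'b) \<Rightarrow> bool" where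
  "isometric_embedding A B f \<longleftrightarrow>
     f ` mspace A \<subseteq> mspace B \<and>
     (\<forall>x\<in>mspace A. \<forall>y\<in>mspace A. mdist B (f x) (f y) = mdist A x y)"

definition isometric :: "'a metric \<Rightarrow> 'b metric \<Rightarrow> bool" where
  "isometric A B \<longleftrightarrow> (\<exists>f. isometric_embedding A B f \<and> f ` mspace A = mspace B)"

(* The finite spaces L are taken with points in nat, since a definition cannot quantify
   over types; finitely_injectiveD below recovers the property for arbitrary point types.
   K may be empty. *)
definition finitely_injective :: "'a metric \<Rightarrow> bool" where
  "finitely_injective U \<longleftrightarrow>
     (\<forall>(L :: nat metric) K \<phi>.
        finite (mspace L) \<and> K \<subseteq> mspace L \<and> isometric_embedding (submetric L K) U \<phi> \<longrightarrow>
        (\<exists>\<psi>. isometric_embedding L U \<psi> \<and> (\<forall>x\<in>K. \<psi> x = \<phi> x)))"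

(* These properties determine the space up to isometry. *)
definition urysohn_space :: "'a metric \<Rightarrow> bool" where
  "urysohn_space U \<longleftrightarrow>
     mspace U \<noteq> {} \<and> mcomplete_of U \<and> separable_space (mtopology_of U) \<and> finitely_injective U"

definition heine_borel_space :: "'a metric \<Rightarrow> bool" where
  "heine_borel_space X \<longleftrightarrow>
     mcomplete_of X \<and> separable_space (mtopology_of X) \<and>
     (\<forall>x\<in>mspace X. \<forall>r. compactin (mtopology_of X) (mcball_of X x r))"

(* Extended-real valued so that the distance to the empty set is infinity
   (the library's infdist and setdist give 0 there). *)
definition dist_to_set :: "'a metric \<Rightarrow> 'a \<Rightarrow> 'a set \<Rightarrow> ereal" where
  "dist_to_set U z X = (INF x\<in>X. ereal (mdist U z x))"

lemma finitely_injectiveD: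
  fixes L :: "'b metric" and U :: "'a metric"
  assumes U: "finitely_injective U" and fin: "finite (mspace L)" and K: "K \<subseteq> mspace L"
    and emb: "isometric_embedding (submetric L K) U \<phi>"
  shows "\<exists>\<psi>. isometric_embedding L U \<psi> \<and> (\<forall>x\<in>K. \<psi> x = \<phi> x)"
proof -
  obtain g :: "'b \<Rightarrow> nat" where g: "inj_on g (mspace L)"
    using fin finite_imp_inj_to_nat_seg by blast
  define h where "h = inv_into (mspace L) g"
  have hg: "h (g x) = x" if "x \<in> mspace L" for x
    using that g by (simp add: h_def)
  have ms: "Metric_space (g ` mspace L) (\<lambda>i j. mdist L (h i) (h j))"
    by unfold_locales (auto simp: hg mdist_commute mdist_triangle)
  define N where "N = metric (g ` mspace L, \<lambda>i j. mdist L (h i) (h j))"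
  have N: "mspace N = g ` mspace L" "mdist N = (\<lambda>i j. mdist L (h i) (h j))"
    unfolding N_def using ms by (simp_all add: Metric_space.mspace_metric Metric_space.mdist_metric)
  have KN: "g ` K \<subseteq> mspace N" using K N by auto
  have "mspace (submetric N (g ` K)) = g ` K" "mspace (submetric L K) = K"
    using K KN by auto
  then have "isometric_embedding (submetric N (g ` K)) U (\<phi> \<circ> h)"
    using emb K hg unfolding isometric_embedding_def
    by (auto simp: N subset_iff simp del: mspace_submetric)
  then obtain \<psi> where \<psi>: "isometric_embedding N U \<psi>" "\<forall>i\<in>g ` K. \<psi> i = (\<phi> \<circ> h) i"
    using U fin KN N unfolding finitely_injective_def by (metis finite_imageI)
  have "isometric_embedding L U (\<psi> \<circ> g)"
    using \<psi>(1) hg unfolding isometric_embedding_def by (auto simp: N)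
  moreover have "\<forall>x\<in>K. (\<psi> \<circ> g) x = \<phi> x"
    using \<psi>(2) hg K by auto
  ultimately show ?thesis by blast
qed

end

(* Finite injectivity reduces to realizing Katetov functions f on finite sets F as distance
   functions mdist U z of a single point z. A realization that stays at distance at least M from X
   is obtained by extending f to F together with a compact piece of X by the largest admissible
   values f y + mdist U y x, and realizing this extension with completeness; the remaining part
   of X is too far from F to matter. Hence the points at distance at least M from X form again a
   complete separable space with the one-point extension property, and back-and-forth between
   dense sequences shows that any two such spaces are isometric. *)
theory Submission
  imports Defs
begin

section \<open>Katetov functions and one-point extensions\<close>

text \<open>These are the triangle inequalities of \<open>F\<close> with one more point at distance
  \<open>f x\<close> from each \<open>x\<close>. The value 0 is allowed; the added point then falls
  onto a point of \<open>F\<close>.\<close>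

definition katetov_on :: "'a metric \<Rightarrow> 'a set \<Rightarrow> ('a \<Rightarrow> real) \<Rightarrow> bool" where
  "katetov_on U F f \<longleftrightarrow>
     (\<forall>x\<in>F. \<forall>y\<in>F. f x \<le> f y + mdist U x y \<and> mdist U x y \<le> f x + f y)"

text \<open>Finite injectivity without auxiliary spaces: only subsets of \<open>U\<close> occur, so
  the property can be checked directly for a subspace. The case \<open>F = {}\<close> forces a point
  to exist.\<close>

definition one_point_injective :: "'a metric \<Rightarrow> bool" where
  "one_point_injective U \<longleftrightarrow>
     (\<forall>F f. finite F \<and> F \<subseteq> mspace U \<and> katetov_on U F f \<longrightarrow>
        (\<exists>z\<in>mspace U. \<forall>x\<in>F. mdist U z x = f x))"

text \<open>A relation rather than a function, so that converses and increasing unions stay within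
  the notion. It is single-valued in both directions, since two partners of the same point lie at
  distance 0.\<close>

definition partial_isometry :: "'a metric \<Rightarrow> 'b metric \<Rightarrow> ('a \<times> 'b) set \<Rightarrow> bool" where
  "partial_isometry U V P \<longleftrightarrow> P \<subseteq> mspace U \<times> mspace V \<and>
     (\<forall>x y x' y'. (x, y) \<in> P \<and> (x', y') \<in> P \<longrightarrow> mdist V y y' = mdist U x x')"

lemma mdist_refl [simp]: "x \<in> mspace U \<Longrightarrow> mdist U x x = 0"
  by simp

lemma katetov_onD:
  assumes "katetov_on U F f" "x \<in> F" "y \<in> F"
  shows "f x \<le> f y + mdist U x y" "mdist U x y \<le> f x + f y" "f y \<le> f x + mdist U x y"
  using assms unfolding katetov_on_def by (blast, blast, metis mdist_commute)

lemma katetov_on_nonneg: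
  assumes "katetov_on U F f" "x \<in> F"
  shows "0 \<le> f x"
  using katetov_onD[OF assms(1) assms(2) assms(2)] mdist_nonneg[of U x x] by linarith

lemma katetov_on_mono: "katetov_on U G f \<Longrightarrow> F \<subseteq> G \<Longrightarrow> katetov_on U F f"
  by (auto simp: katetov_on_def)

lemma one_point_injectiveD:
  assumes "one_point_injective U" "finite F" "F \<subseteq> mspace U" "katetov_on U F f"
  shows "\<exists>z\<in>mspace U. \<forall>x\<in>F. mdist U z x = f x"
  using assms by (auto simp: one_point_injective_def)

lemma one_point_injective_nonempty: "one_point_injective U \<Longrightarrow> mspace U \<noteq> {}"
  using one_point_injectiveD[of U "{}"] by (auto simp: katetov_on_def)

text \<open>If \<open>f\<close> has no zero, \<open>F\<close> with a new point at the distances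
  \<open>f\<close> is a finite metric space, and extending the inclusion of \<open>F\<close> to it
  yields the realization. A zero of \<open>f\<close> is itself a realization.\<close>

lemma finitely_injective_imp_one_point_injective:
  fixes U :: "'a metric"
  assumes U: "finitely_injective U"
  shows "one_point_injective U"
  unfolding one_point_injective_def
proof (intro allI impI, elim conjE)
  fix F :: "'a set" and f
  assume fin: "finite F" and F: "F \<subseteq> mspace U" and f: "katetov_on U F f"
  note fD = katetov_onD[OF f]
  show "\<exists>z\<in>mspace U. \<forall>x\<in>F. mdist U z x = f x"
  proof (cases "\<exists>z\<in>F. f z = 0")
    case True
    then obtain z where z: "z \<in> F" "f z = 0" by blast
    have "mdist U z x = f x" if "x \<in> F" for x
      using fD[OF \<open>x \<in> F\<close> z(1)] z(2) by (simp add: mdist_commute)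
    with z F show ?thesis by blast
  next
    case False
    then have pos: "f x > 0" if "x \<in> F" for x
      using katetov_on_nonneg[OF f that] that by force
    \<comment> \<open>\<open>None\<close> is the new point and \<open>Some x\<close> the copy of
      \<open>x\<close>.\<close>
    define \<delta> where "\<delta> p q = (case p of
        None \<Rightarrow> (case q of None \<Rightarrow> 0 | Some y \<Rightarrow> f y)
      | Some x \<Rightarrow> (case q of None \<Rightarrow> f x | Some y \<Rightarrow> mdist U x y))" for p q
    define S where "S = insert None (Some ` F)"
    \<comment> \<open>The cutoff outside \<open>S\<close> is there because nonnegativity is demanded
      of all pairs, whereas \<open>f\<close> may be negative outside \<open>F\<close>.\<close>
    have "Metric_space S (\<lambda>p q. if p \<in> S \<and> q \<in> S then \<delta> p q else 0)"
    proof
      fix p q r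
      show "0 \<le> (if p \<in> S \<and> q \<in> S then \<delta> p q else 0)"
        using pos by (auto simp: S_def \<delta>_def less_imp_le)
      show "(if p \<in> S \<and> q \<in> S then \<delta> p q else 0) = (if q \<in> S \<and> p \<in> S then \<delta> q p else 0)"
        by (auto simp: \<delta>_def mdist_commute split: option.splits)
      assume p: "p \<in> S" and q: "q \<in> S"
      show "(if p \<in> S \<and> q \<in> S then \<delta> p q else 0) = 0 \<longleftrightarrow> p = q"
        using p q pos F by (auto simp: S_def \<delta>_def subset_iff dest: pos)
      assume r: "r \<in> S"
      show "(if p \<in> S \<and> r \<in> S then \<delta> p r else 0) \<le>
            (if p \<in> S \<and> q \<in> S then \<delta> p q else 0) + (if q \<in> S \<and> r \<in> S then \<delta> q r else 0)"
      proof (cases p; cases q; cases r)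
        fix x y z assume "p = Some x" "q = Some y" "r = Some z"
        then show ?thesis using p q r F by (auto simp: S_def \<delta>_def intro!: mdist_triangle)
      qed (use p q r F pos fD in \<open>auto simp: S_def \<delta>_def mdist_commute add.commute less_imp_le\<close>)
    qed
    then interpret L: Metric_space S "\<lambda>p q. if p \<in> S \<and> q \<in> S then \<delta> p q else 0" .
    define L where "L = metric (S, \<lambda>p q. if p \<in> S \<and> q \<in> S then \<delta> p q else 0)"
    have L: "mspace L = S" "mdist L = (\<lambda>p q. if p \<in> S \<and> q \<in> S then \<delta> p q else 0)"
      by (simp_all add: L_def)
    have "isometric_embedding (submetric L (Some ` F)) U the"
      using F by (auto simp: isometric_embedding_def L S_def \<delta>_def)
    moreover have "finite (mspace L)" "Some ` F \<subseteq> mspace L"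
      using fin by (auto simp: L S_def)
    ultimately obtain \<psi> where \<psi>: "isometric_embedding L U \<psi>" "\<forall>p\<in>Some ` F. \<psi> p = the p"
      using finitely_injectiveD[OF U] by blast
    have "\<psi> None \<in> mspace U"
      using \<psi>(1) by (auto simp: isometric_embedding_def L S_def)
    moreover have "mdist U (\<psi> None) x = f x" if "x \<in> F" for x
    proof -
      have "mdist U (\<psi> None) (\<psi> (Some x)) = mdist L None (Some x)"
        using \<psi>(1) that by (auto simp: isometric_embedding_def L S_def)
      with \<psi>(2) that show ?thesis by (simp add: L S_def \<delta>_def)
    qed
    ultimately show ?thesis by blast
  qed
qed

section \<open>Realization on totally bounded sets and away from \<open>X\<close>\<close>

lemma abs_mdist_diff_le:
  assumes "x \<in> mspace U" "y \<in> mspace U" "z \<in> mspace U"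
  shows "\<bar>mdist U x z - mdist U y z\<bar> \<le> mdist U x y"
  using Metric_space.mdist_reverse_triangle[OF Metric_space_mspace_mdist assms(1,3,2)]
  by (simp add: mdist_commute)

text \<open>Prescribing the maximal error as the distance to \<open>z\<close> extends
  \<open>g\<close> to a Katetov function on \<open>insert z N\<close>; a realization of the
  extension is exact on \<open>N\<close> and near \<open>z\<close>.\<close>

lemma one_point_injective_correction:
  assumes U: "one_point_injective U" and N: "finite N" "N \<subseteq> mspace U"
    and g: "katetov_on U N g" and z: "z \<in> mspace U"
    and err: "\<And>x. x \<in> N \<Longrightarrow> \<bar>mdist U z x - g x\<bar> \<le> \<epsilon>" and "0 \<le> \<epsilon>"
  shows "\<exists>w\<in>mspace U. mdist U w z \<le> \<epsilon> \<and> (\<forall>x\<in>N. mdist U w x = g x)"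
\<comment> \<open>If \<open>z \<in> N\<close>, then \<open>g z\<close> is itself the error at
  \<open>z\<close>, so any realization is near \<open>z\<close>. If \<open>N = {}\<close>, there is
  no maximal error and \<open>z\<close> itself serves.\<close>
proof (cases "z \<in> N \<or> N = {}")
  case True
  obtain w where w: "w \<in> mspace U" "\<forall>x\<in>N. mdist U w x = g x"
    using one_point_injectiveD[OF U N g] by blast
  show ?thesis
  proof (cases "z \<in> N")
    case True
    then have "mdist U w z \<le> \<epsilon>" using w err[of z] z by auto
    with w show ?thesis by blast
  next
    case False
    with True z \<open>0 \<le> \<epsilon>\<close> show ?thesis by (intro bexI[of _ z]) auto
  qed
next
  case False
  \<comment> \<open>The attained maximum is used and not \<open>\<epsilon>\<close>, which may exceed
    \<open>g x + mdist U z x\<close> and so violate the Katetov inequalities.\<close>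
  define e where "e = Max ((\<lambda>x. \<bar>mdist U z x - g x\<bar>) ` N)"
  have "e \<in> (\<lambda>x. \<bar>mdist U z x - g x\<bar>) ` N"
    unfolding e_def using N False by (intro Max_in) auto
  then obtain y where y: "y \<in> N" "e = \<bar>mdist U z y - g y\<bar>" by blast
  have le: "\<bar>mdist U z x - g x\<bar> \<le> e" if "x \<in> N" for x
    unfolding e_def using N that by (intro Max_ge) auto
  \<comment> \<open>The error at the maximizing \<open>y\<close>, whatever its sign, is bounded by a
    detour through \<open>x\<close>.\<close>
  have up: "e \<le> g x + mdist U z x" if x: "x \<in> N" for x
  proof -
    have "mdist U z y \<le> mdist U z x + mdist U x y" "mdist U x y \<le> g x + g y"
      "g y \<le> g x + mdist U x y" "mdist U x y \<le> mdist U z x + mdist U z y"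
      using mdist_triangle[of z U x y] mdist_triangle[of x U z y] katetov_onD[OF g x y(1)] x y(1) z N
      by (auto simp: mdist_commute[of U x z])
    then show ?thesis using y(2) by linarith
  qed
  define h where "h x = (if x = z then e else g x)" for x
  have h: "h x = g x" if "x \<in> N" for x using that False by (auto simp: h_def)
  have hz: "h z = e" by (simp add: h_def)
  have "0 \<le> e" using y(2) by simp
  have "katetov_on U (insert z N) h"
    unfolding katetov_on_def
  proof (intro ballI)
    fix a b assume a: "a \<in> insert z N" and b: "b \<in> insert z N"
    show "h a \<le> h b + mdist U a b \<and> mdist U a b \<le> h a + h b"
    proof (cases "a = z"; cases "b = z")
      assume "a = z" "b = z" then show ?thesis using \<open>0 \<le> e\<close> z by (simp add: hz)
    next
      assume "a = z" "b \<noteq> z" then show ?thesis using b le[of b] up[of b] by (auto simp: hz h)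
    next
      assume "a \<noteq> z" "b = z" then show ?thesis using a le[of a] up[of a]
        by (auto simp: hz h mdist_commute[of U a z])
    next
      assume "a \<noteq> z" "b \<noteq> z" then show ?thesis using a b katetov_onD[OF g] by (simp add: h)
    qed
  qed
  then obtain w where w: "w \<in> mspace U" "\<forall>x\<in>insert z N. mdist U w x = h x"
    using one_point_injectiveD[OF U, of "insert z N" h] N z by auto
  have "e \<le> \<epsilon>" using y err by auto
  then show ?thesis using w h hz by (intro bexI[of _ w]) auto
qed

text \<open>The distance to \<open>w\<close> and \<open>g\<close> are both 1-Lipschitz on
  \<open>C\<close> and agree on the net, so each contributes one \<open>\<delta>\<close>.\<close>

lemma katetov_on_net_error:
  assumes C: "C \<subseteq> mspace U" and g: "katetov_on U C g" and w: "w \<in> mspace U"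
    and N: "N \<subseteq> C" "\<And>x. x \<in> C \<Longrightarrow> \<exists>y\<in>N. mdist U y x < \<delta>"
    and eq: "\<And>y. y \<in> N \<Longrightarrow> mdist U w y = g y" and x: "x \<in> C"
  shows "\<bar>mdist U w x - g x\<bar> \<le> 2 * \<delta>"
proof -
  obtain y where y: "y \<in> N" "mdist U y x < \<delta>" using N(2)[OF x] by blast
  have "\<bar>mdist U x w - mdist U y w\<bar> \<le> mdist U x y"
    using abs_mdist_diff_le[of x U y w] C N x y w by blast
  moreover have "\<bar>g x - g y\<bar> \<le> mdist U x y"
    using katetov_onD(1)[OF g, of x y] katetov_onD(1)[OF g, of y x] x y N
    by (auto simp: mdist_commute[of U y x])
  ultimately show ?thesis using y eq[of y] by (auto simp: mdist_commute)
qed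

lemma mcomplete_of_geometric:
  assumes "mcomplete_of U" and s: "\<And>n. s n \<in> mspace U"
    and step: "\<And>n. mdist U (s (Suc n)) (s n) \<le> (1/2)^n"
  obtains l where "l \<in> mspace U" "(\<lambda>n. mdist U (s n) l) \<longlonglongrightarrow> 0"
proof -
  interpret Metric_space "mspace U" "mdist U" by (rule Metric_space_mspace_mdist)
  \<comment> \<open>The bound is the exact geometric sum of the steps from \<open>n\<close> to
    \<open>n + k\<close>; the subtracted term makes the induction close.\<close>
  have dist: "mdist U (s n) (s (n + k)) \<le> 2 * (1/2)^n - 2 * (1/2)^(n+k)" for n k
  proof (induction k)
    case 0
    show ?case using s by simp
  next
    case (Suc k)
    have "mdist U (s n) (s (Suc (n + k))) \<le> mdist U (s n) (s (n + k)) + mdist U (s (n + k)) (s (Suc (n + k)))"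
      by (intro mdist_triangle s)
    with Suc step[of "n + k"] show ?case by (simp add: mdist_commute)
  qed
  have "MCauchy s"
    unfolding MCauchy_def
  proof (intro conjI allI impI)
    show "range s \<subseteq> mspace U" using s by auto
  next
    fix \<epsilon> :: real assume "\<epsilon> > 0"
    \<comment> \<open>A quarter, because each of the two legs through \<open>s N\<close> costs up to
      \<open>2 * (1/2)^N\<close>.\<close>
    then obtain N where N: "(1/2)^N < \<epsilon>/4"
      using real_arch_pow_inv[of "\<epsilon>/4" "1/2"] by auto
    have near: "mdist U (s N) (s n) \<le> 2 * (1/2)^N" if "N \<le> n" for n
      using dist[of N "n - N"] that by (simp add: order_trans)
    have "mdist U (s n) (s n') < \<epsilon>" if "N \<le> n" "N \<le> n'" for n n'
    proof -
      have "mdist U (s n) (s n') \<le> mdist U (s n) (s N) + mdist U (s N) (s n')"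
        by (intro mdist_triangle s)
      with near[OF that(1)] near[OF that(2)] N show ?thesis by (simp add: mdist_commute)
    qed
    then show "\<exists>N. \<forall>n n'. N \<le> n \<longrightarrow> N \<le> n' \<longrightarrow> mdist U (s n) (s n') < \<epsilon>" by blast
  qed
  then obtain l where "limitin mtopology s l sequentially"
    using assms(1) by (auto simp: mcomplete_of_def mcomplete_def)
  then have "l \<in> mspace U" "(\<lambda>n. mdist U (s n) l) \<longlonglongrightarrow> 0"
    by (auto simp: limitin_metric_dist_null)
  then show thesis by (rule that)
qed

text \<open>Realize \<open>g\<close> exactly on finer and finer finite nets. By the correction lemma each
  realization can be chosen close to the previous one, so that they converge.\<close>

lemma one_point_injective_totally_bounded:
  assumes U: "one_point_injective U" and complete: "mcomplete_of U"
    and tb: "Metric_space.mtotally_bounded (mspace U) (mdist U) C"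
    and g: "katetov_on U C g"
  shows "\<exists>z\<in>mspace U. \<forall>x\<in>C. mdist U z x = g x"
proof -
  interpret Metric_space "mspace U" "mdist U" by (rule Metric_space_mspace_mdist)
  have C: "C \<subseteq> mspace U" using tb by (rule mtotally_bounded_imp_subset)
  have net: "\<exists>N. finite N \<and> N \<subseteq> C \<and> (\<forall>x\<in>C. \<exists>y\<in>N. mdist U y x < \<delta>)" if "\<delta> > 0" for \<delta>
  proof -
    obtain N where N: "finite N" "N \<subseteq> C" "C \<subseteq> (\<Union>y\<in>N. mball y \<delta>)"
      using tb[unfolded mtotally_bounded_def, rule_format, OF \<open>\<delta> > 0\<close>] by (elim exE conjE)
    have "\<exists>y\<in>N. mdist U y x < \<delta>" if "x \<in> C" for x
      using subsetD[OF N(3) that] by auto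
    with N(1,2) show ?thesis by blast
  qed
  \<comment> \<open>The error is controlled on all of \<open>C\<close>, so the next stage may use an
    unrelated net.\<close>
  define good where "good n z \<longleftrightarrow> z \<in> mspace U \<and> (\<forall>x\<in>C. \<bar>mdist U z x - g x\<bar> \<le> (1/2)^n)" for n z
  have "\<exists>s. \<forall>n. good n (s n) \<and> mdist U (s (Suc n)) (s n) \<le> (1/2)^n"
  proof (rule dependent_nat_choice)
    \<comment> \<open>Mesh \<open>1/2\<close> gives error at most 1, the tolerance of stage
      0.\<close>
    obtain N where N: "finite N" "N \<subseteq> C" "\<forall>x\<in>C. \<exists>y\<in>N. mdist U y x < 1/2"
      using net[of "1/2"] by auto
    obtain z where z: "z \<in> mspace U" "\<forall>x\<in>N. mdist U z x = g x"
      using one_point_injectiveD[OF U N(1) _ katetov_on_mono[OF g N(2)]] N C by blast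
    have "\<bar>mdist U z x - g x\<bar> \<le> 2 * (1/2)" if "x \<in> C" for x
      using katetov_on_net_error[OF C g z(1) N(2) _ _ that] N z by blast
    then show "\<exists>z. good 0 z" using z by (auto simp: good_def)
  next
    fix z n assume z: "good n z"
    \<comment> \<open>The net error doubles the mesh, hence half of the next tolerance. The
      correction moves \<open>z\<close> by at most the present tolerance.\<close>
    obtain N where N: "finite N" "N \<subseteq> C" "\<forall>x\<in>C. \<exists>y\<in>N. mdist U y x < (1/2)^Suc n / 2"
      using net[of "(1/2)^Suc n / 2"] by auto
    obtain w where w: "w \<in> mspace U" "mdist U w z \<le> (1/2)^n" "\<forall>x\<in>N. mdist U w x = g x"
      using one_point_injective_correction[OF U N(1) _ katetov_on_mono[OF g N(2)], of z "(1/2)^n"]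
        N(2) C z by (auto simp: good_def subset_iff)
    have "\<bar>mdist U w x - g x\<bar> \<le> 2 * ((1/2)^Suc n / 2)" if "x \<in> C" for x
      using katetov_on_net_error[OF C g w(1) N(2) _ _ that] N w by blast
    then show "\<exists>w. good (Suc n) w \<and> mdist U w z \<le> (1/2)^n"
      using w by (auto simp: good_def)
  qed
  then obtain s where s: "\<And>n. good n (s n)" "\<And>n. mdist U (s (Suc n)) (s n) \<le> (1/2)^n"
    by blast
  have sU: "s n \<in> mspace U" for n using s(1) by (simp add: good_def)
  obtain l where l: "l \<in> mspace U" "(\<lambda>n. mdist U (s n) l) \<longlonglongrightarrow> 0"
    using mcomplete_of_geometric[OF complete sU s(2)] by blast
  have "mdist U l x = g x" if x: "x \<in> C" for x
  proof -
    have "\<bar>mdist U l x - g x\<bar> \<le> mdist U (s n) l + (1/2)^n" for n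
    proof -
      have "\<bar>mdist U (s n) x - g x\<bar> \<le> (1/2)^n" using s(1) x by (simp add: good_def)
      then show ?thesis
        using abs_mdist_diff_le[of "s n" U l x] sU[of n] l(1) x C by auto
    qed
    moreover have "(\<lambda>n. mdist U (s n) l + (1/2)^n) \<longlonglongrightarrow> 0 + 0"
      by (intro tendsto_add l LIMSEQ_realpow_zero) auto
    ultimately have "\<bar>mdist U l x - g x\<bar> \<le> 0 + 0"
      by (intro LIMSEQ_le_const) auto
    then show ?thesis by simp
  qed
  with l show ?thesis by blast
qed

text \<open>Points of \<open>X\<close> outside a large ball are far from any realization of \<open>f\<close>; on the compact
  remainder, the largest Katetov extension of \<open>f\<close> is at least \<open>M\<close>.\<close>

lemma one_point_injective_avoiding:
  assumes U: "one_point_injective U" and complete: "mcomplete_of U"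
    and X: "X \<subseteq> mspace U" and hb: "heine_borel_space (submetric U X)"
    and F: "finite F" "F \<noteq> {}" "F \<subseteq> mspace U" and f: "katetov_on U F f"
    and far: "\<And>x y. x \<in> X \<Longrightarrow> y \<in> F \<Longrightarrow> M \<le> f y + mdist U y x"
  shows "\<exists>z\<in>mspace U. (\<forall>y\<in>F. mdist U z y = f y) \<and> (\<forall>x\<in>X. M \<le> mdist U z x)"
proof -
  interpret Metric_space "mspace U" "mdist U" by (rule Metric_space_mspace_mdist)
  obtain y0 where y0: "y0 \<in> F" using F by blast
  \<comment> \<open>A point of \<open>X\<close> beyond this radius is more than \<open>M\<close>
    away from every \<open>z\<close> with \<open>mdist U z y0 = f y0\<close>.\<close>
  define C where "C = {x \<in> X. mdist U y0 x \<le> M + f y0}"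
  have tbC: "mtotally_bounded C"
  proof (cases "C = {}")
    case False
    then obtain x0 where x0: "x0 \<in> C" by blast
    \<comment> \<open>Compactness is known for balls centred in \<open>X\<close>, and
      \<open>y0\<close> need not lie there; recentring at \<open>x0\<close> doubles the
      radius.\<close>
    define R where "R = 2 * (M + f y0)"
    have x0X: "x0 \<in> X" using x0 by (simp add: C_def)
    define B where "B = mcball_of (submetric U X) x0 R"
    have "compactin (mtopology_of (submetric U X)) B"
      using hb x0X X by (auto simp: heine_borel_space_def B_def)
    then have "compactin mtopology B"
      unfolding mtopology_of_submetric compactin_subtopology by (simp add: mtopology_of_def)
    then have "mtotally_bounded B"
      by (simp add: compactin_imp_mtotally_bounded)
    moreover have "C \<subseteq> B"
    proof
      fix x assume x: "x \<in> C"
      have "mdist U x0 x \<le> mdist U x0 y0 + mdist U y0 x"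
        using x x0 y0 X F by (intro mdist_triangle) (auto simp: C_def)
      with x x0 have "mdist U x0 x \<le> R" by (simp add: C_def R_def mdist_commute)
      with x x0 X show "x \<in> B" by (auto simp: B_def C_def)
    qed
    ultimately show ?thesis by (rule mtotally_bounded_subset)
  qed simp
  \<comment> \<open>The minimum is attained, so for \<open>x \<in> X\<close> the assumption
    \<open>far\<close> at the minimizing point gives \<open>M \<le> g x\<close>.\<close>
  define g where "g x = Min ((\<lambda>y. f y + mdist U y x) ` F)" for x
  have g_le: "g x \<le> f y + mdist U y x" if "y \<in> F" for x y
    unfolding g_def using F that by (intro Min_le) auto
  have g_at: "\<exists>y\<in>F. g x = f y + mdist U y x" for x
  proof -
    have "g x \<in> (\<lambda>y. f y + mdist U y x) ` F"
      unfolding g_def using F by (intro Min_in) auto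
    then show ?thesis by auto
  qed
  have g_ext: "g x = f x" if x: "x \<in> F" for x
  proof (rule antisym)
    show "g x \<le> f x" using g_le[OF x, of x] x F by auto
    obtain y where "y \<in> F" "g x = f y + mdist U y x" using g_at by blast
    then show "f x \<le> g x" using katetov_onD(1)[OF f x, of y] by (simp add: mdist_commute)
  qed
  have "katetov_on U (F \<union> C) g"
    unfolding katetov_on_def
  proof (intro ballI conjI)
    fix a b assume ab: "a \<in> F \<union> C" "b \<in> F \<union> C"
    then have abU: "a \<in> mspace U" "b \<in> mspace U" using F X by (auto simp: C_def)
    \<comment> \<open>The minimizer \<open>q\<close> for \<open>b\<close> competes in the minimum
      for \<open>a\<close>; the second inequality follows the path from \<open>a\<close> through
      \<open>p\<close> and \<open>q\<close> to \<open>b\<close>.\<close>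
    obtain p where p: "p \<in> F" "g a = f p + mdist U p a" using g_at by blast
    obtain q where q: "q \<in> F" "g b = f q + mdist U q b" using g_at by blast
    have pqU: "p \<in> mspace U" "q \<in> mspace U" using p q F by auto
    show "g a \<le> g b + mdist U a b"
      using g_le[OF q(1), of a] q(2) mdist_triangle[OF pqU(2) abU(2,1)]
      by (simp add: mdist_commute)
    show "mdist U a b \<le> g a + g b"
      using p(2) q(2) katetov_onD(2)[OF f p(1) q(1)]
        mdist_triangle[OF abU(1) pqU(1) abU(2)] mdist_triangle[OF pqU abU(2)]
      by (simp add: mdist_commute)
  qed
  moreover have "mtotally_bounded (F \<union> C)"
    using tbC F by (simp add: mtotally_bounded_Un finite_imp_mtotally_bounded)
  ultimately obtain z where z: "z \<in> mspace U" "\<forall>x\<in>F \<union> C. mdist U z x = g x"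
    using one_point_injective_totally_bounded[OF U complete] by blast
  have "M \<le> mdist U z x" if x: "x \<in> X" for x
  proof (cases "x \<in> C")
    case True
    then show ?thesis using z(2) g_at[of x] far[OF x] by fastforce
  next
    case False
    then have "M + f y0 < mdist U y0 x" using x by (simp add: C_def)
    moreover have "mdist U y0 x \<le> mdist U y0 z + mdist U z x"
      using y0 z(1) x X F by (intro mdist_triangle) auto
    moreover have "mdist U z y0 = f y0" using z(2) y0 g_ext by simp
    ultimately show ?thesis by (simp add: mdist_commute)
  qed
  with z g_ext show ?thesis by (intro bexI[of _ z]) auto
qed

section \<open>Partial isometries and their one-point extension\<close>

lemma partial_isometryD:
  assumes "partial_isometry U V P" "(x, y) \<in> P"
  shows "x \<in> mspace U" "y \<in> mspace V"
    "(x', y') \<in> P \<Longrightarrow> mdist V y y' = mdist U x x'"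
  using assms by (auto simp: partial_isometry_def)

lemma partial_isometry_converse: "partial_isometry U V P \<Longrightarrow> partial_isometry V U (P\<inverse>)"
  by (auto simp: partial_isometry_def)

text \<open>By the triangle inequality in \<open>U\<close>, the distances from \<open>a\<close>,
  carried over to \<open>Range P\<close>, form a Katetov function there; its realization in
  \<open>V\<close> is the partner of \<open>a\<close>.\<close>

lemma partial_isometry_extend:
  assumes V: "one_point_injective V" and P: "partial_isometry U V P" "finite P"
    and a: "a \<in> mspace U"
  obtains b where "partial_isometry U V (insert (a, b) P)"
proof -
  \<comment> \<open>The choice does not matter: two partners of \<open>y\<close> lie at distance
    \<open>mdist V y y = 0\<close>.\<close>
  define f where "f y = mdist U a (SOME x. (x, y) \<in> P)" for y
  have f: "f y = mdist U a x" if xy: "(x, y) \<in> P" for x y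
  proof -
    have "(SOME x. (x, y) \<in> P, y) \<in> P" using xy by (rule someI)
    then have "mdist U (SOME x. (x, y) \<in> P) x = mdist V y y" "(SOME x. (x, y) \<in> P) \<in> mspace U"
      using partial_isometryD[OF P(1)] xy by metis+
    then have "(SOME x. (x, y) \<in> P) = x"
      using partial_isometryD(1,2)[OF P(1) xy] by simp
    then show ?thesis by (simp add: f_def)
  qed
  have "katetov_on V (Range P) f"
    unfolding katetov_on_def
  proof (intro ballI)
    fix y y' assume "y \<in> Range P" "y' \<in> Range P"
    then obtain x x' where xy: "(x, y) \<in> P" "(x', y') \<in> P" by blast
    note D = partial_isometryD[OF P(1) xy(1)] partial_isometryD[OF P(1) xy(2)]
    show "f y \<le> f y' + mdist V y y' \<and> mdist V y y' \<le> f y + f y'"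
      using mdist_triangle[OF a D(4,1)] mdist_triangle[OF D(1) a D(4)] f xy D(3)[OF xy(2)]
      by (simp add: mdist_commute)
  qed
  moreover have "finite (Range P)" "Range P \<subseteq> mspace V"
    using P partial_isometryD(2)[OF P(1)] by (auto simp: finite_Range)
  ultimately obtain b where b: "b \<in> mspace V" "\<forall>y\<in>Range P. mdist V b y = f y"
    using one_point_injectiveD[OF V] by blast
  then have "mdist V b y = mdist U a x" if "(x, y) \<in> P" for x y
    using f that by (auto simp: Range.intros)
  then have "partial_isometry U V (insert (a, b) P)"
    using P a b(1) unfolding partial_isometry_def
    by (auto simp: mdist_commute)
  then show thesis by (rule that)
qed

section \<open>Dense sequences and separable subspaces\<close>

lemma separable_metric_dense_sequence:
  assumes "separable_space (mtopology_of U)" "mspace U \<noteq> {}"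
  obtains u :: "nat \<Rightarrow> 'a" where "\<And>n. u n \<in> mspace (U :: 'a metric)"
    "\<And>x \<epsilon>. x \<in> mspace U \<Longrightarrow> \<epsilon> > 0 \<Longrightarrow> \<exists>n. mdist U x (u n) < \<epsilon>"
proof -
  interpret Metric_space "mspace U" "mdist U" by (rule Metric_space_mspace_mdist)
  obtain C where C: "countable C" "C \<subseteq> mspace U" "mtopology closure_of C = mspace U"
    using assms(1) by (auto simp: separable_space_def mtopology_of_def)
  have dense: "\<exists>c\<in>C. mdist U x c < \<epsilon>" if "x \<in> mspace U" "\<epsilon> > 0" for x \<epsilon>
    using that C(3) by (force simp: metric_closure_of)
  then have "C \<noteq> {}" using assms(2) zero_less_one by blast
  then have range: "range (from_nat_into C) = C" using C(1) by simp
  show thesis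
  proof (rule that[of "from_nat_into C"])
    show "from_nat_into C n \<in> mspace U" for n using range C(2) by blast
    show "\<exists>n. mdist U x (from_nat_into C n) < \<epsilon>" if "x \<in> mspace U" "\<epsilon> > 0" for x \<epsilon>
      using dense[OF that] range by (metis rangeE)
  qed
qed

text \<open>A dense sequence of \<open>U\<close> may miss \<open>S\<close>. Instead, for each of its
  terms and each radius \<open>1/(k+1)\<close>, a point of the subspace within that radius is
  picked, if there is one.\<close>

lemma separable_space_submetric:
  assumes U: "separable_space (mtopology_of U)"
  shows "separable_space (mtopology_of (submetric U S))"
proof (cases "S \<inter> mspace U = {}")
  case True
  then show ?thesis by (auto simp: separable_space_def)
next
  case False
  let ?T = "submetric U S"
  interpret Metric_space "mspace ?T" "mdist ?T" by (rule Metric_space_mspace_mdist)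
  obtain u :: "nat \<Rightarrow> 'a" where u: "\<And>n. u n \<in> mspace U"
    "\<And>x \<epsilon>. x \<in> mspace U \<Longrightarrow> \<epsilon> > 0 \<Longrightarrow> \<exists>n. mdist U x (u n) < \<epsilon>"
    using separable_metric_dense_sequence[OF U] False by blast
  obtain p0 where p0: "p0 \<in> mspace ?T" using False by auto
  define near where "near n k p \<longleftrightarrow> p \<in> mspace ?T \<and> mdist U p (u n) < inverse (real (Suc k))" for n k p
  \<comment> \<open>The default \<open>p0\<close> keeps every value inside the subspace.\<close>
  define pick where "pick = (\<lambda>(n, k). if \<exists>p. near n k p then SOME p. near n k p else p0)"
  have pick_near: "near n k (pick (n, k))" if "near n k p" for n k p
    using that by (auto simp: pick_def intro: someI)
  have pick_in: "pick nk \<in> mspace ?T" for nk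
    using p0 pick_near unfolding pick_def near_def
    by (auto split: prod.splits dest!: someI_ex[of "\<lambda>p. _ p \<and> _ p"])
  have dense: "\<exists>c\<in>range pick. c \<in> mball x \<epsilon>" if x: "x \<in> mspace ?T" and "\<epsilon> > 0" for x \<epsilon>
  proof -
    \<comment> \<open>Half of \<open>\<epsilon>\<close>, since \<open>x\<close> and the picked point
      both lie within this radius of \<open>u n\<close>.\<close>
    obtain k where k: "inverse (real (Suc k)) < \<epsilon> / 2"
      using reals_Archimedean[of "\<epsilon> / 2"] \<open>\<epsilon> > 0\<close> by auto
    obtain n where "mdist U x (u n) < inverse (real (Suc k))"
      using u(2)[of x "inverse (real (Suc k))"] x by auto
    then have nx: "near n k x" using x by (simp add: near_def)
    have "mdist U x (pick (n, k)) \<le> mdist U x (u n) + mdist U (u n) (pick (n, k))"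
      using x u(1) pick_in[of "(n, k)"] by (intro mdist_triangle) auto
    also have "\<dots> < \<epsilon>"
      using nx pick_near[OF nx] k by (simp add: near_def mdist_commute)
    finally have "pick (n, k) \<in> mball x \<epsilon>" using x pick_in[of "(n, k)"]
      unfolding in_mball by simp
    then show ?thesis by blast
  qed
  have "mspace ?T \<subseteq> mtopology closure_of (range pick)"
  proof
    fix x assume "x \<in> mspace ?T"
    then show "x \<in> mtopology closure_of (range pick)"
      unfolding metric_closure_of by (intro CollectI conjI allI impI dense)
  qed
  then have "mtopology closure_of (range pick) = mspace ?T"
    by (intro antisym closure_of_subset_topspace[of mtopology, unfolded topspace_mtopology])
  then show ?thesis
    using pick_in unfolding separable_space_def mtopology_of_def topspace_mtopology
    by (intro exI[of _ "range pick"] conjI image_subsetI) simp_all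
qed

section \<open>Limits of partial isometries and back-and-forth\<close>

text \<open>The partners of a sequence in \<open>Domain R\<close> tending to \<open>x\<close> form a
  Cauchy sequence, because \<open>R\<close> preserves distances; their limit has the required
  distances by continuity.\<close>

lemma partial_isometry_limit_point:
  assumes V: "mcomplete_of V" and R: "partial_isometry U V R"
    and dense: "\<And>\<epsilon>. \<epsilon> > 0 \<Longrightarrow> \<exists>a\<in>Domain R. mdist U x a < \<epsilon>"
    and x: "x \<in> mspace U"
  shows "\<exists>y\<in>mspace V. \<forall>a b. (a, b) \<in> R \<longrightarrow> mdist V y b = mdist U x a"
proof -
  interpret U: Metric_space "mspace U" "mdist U" by (rule Metric_space_mspace_mdist)
  interpret V: Metric_space "mspace V" "mdist V" by (rule Metric_space_mspace_mdist)
  have "\<forall>n. \<exists>a b. (a, b) \<in> R \<and> mdist U x a < inverse (real (Suc n))"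
    using dense by (meson DomainE inverse_positive_iff_positive of_nat_0_less_iff zero_less_Suc)
  then obtain a b where ab: "\<And>n. (a n, b n) \<in> R" "\<And>n. mdist U x (a n) < inverse (real (Suc n))"
    by metis
  note abD = partial_isometryD[OF R ab(1)]
  have a_null: "(\<lambda>n. mdist U (a n) x) \<longlonglongrightarrow> 0"
    by (rule tendsto_sandwich[OF _ _ tendsto_const LIMSEQ_inverse_real_of_nat])
      (use ab(2) in \<open>auto simp: mdist_commute less_imp_le\<close>)
  then have "limitin U.mtopology a x sequentially"
    using x abD(1) by (auto simp: U.limitin_metric_dist_null)
  then have "U.MCauchy a"
    using abD(1) by (intro U.convergent_imp_MCauchy) auto
  then have "V.MCauchy b"
    using abD(2) abD(3)[OF ab(1)] by (auto simp: U.MCauchy_def V.MCauchy_def)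
  then obtain y where "limitin V.mtopology b y sequentially"
    using V by (auto simp: mcomplete_of_def V.mcomplete_def)
  then have y: "y \<in> mspace V" "(\<lambda>n. mdist V (b n) y) \<longlonglongrightarrow> 0"
    by (auto simp: V.limitin_metric_dist_null)
  have "mdist V y d = mdist U x c" if cd: "(c, d) \<in> R" for c d
  proof -
    note cdD = partial_isometryD[OF R cd]
    have "\<bar>mdist V y d - mdist U x c\<bar> \<le> mdist V (b n) y + mdist U (a n) x" for n
      using abs_mdist_diff_le[OF abD(2)[of n] y(1) cdD(2)]
        abs_mdist_diff_le[OF abD(1)[of n] x cdD(1)] abD(3)[OF cd, of n] by linarith
    moreover have "(\<lambda>n. mdist V (b n) y + mdist U (a n) x) \<longlonglongrightarrow> 0 + 0"
      by (intro tendsto_add y a_null)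
    ultimately have "\<bar>mdist V y d - mdist U x c\<bar> \<le> 0 + 0"
      by (intro LIMSEQ_le_const) auto
    then show ?thesis by simp
  qed
  with y show ?thesis by blast
qed

lemma dense_partial_isometry_imp_isometric:
  assumes U: "mcomplete_of U" and V: "mcomplete_of V" and R: "partial_isometry U V R"
    and dense_U: "\<And>x \<epsilon>. x \<in> mspace U \<Longrightarrow> \<epsilon> > 0 \<Longrightarrow> \<exists>a\<in>Domain R. mdist U x a < \<epsilon>"
    and dense_V: "\<And>y \<epsilon>. y \<in> mspace V \<Longrightarrow> \<epsilon> > 0 \<Longrightarrow> \<exists>b\<in>Range R. mdist V y b < \<epsilon>"
  shows "isometric U V"
proof -
  \<comment> \<open>This correspondence is symmetric in the two spaces, so partners on either side
    come from the same lemma, applied to \<open>R\<close> and to its converse.\<close>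
  define E where "E x y \<longleftrightarrow> x \<in> mspace U \<and> y \<in> mspace V \<and>
    (\<forall>a b. (a, b) \<in> R \<longrightarrow> mdist V y b = mdist U x a)" for x y
  have left: "\<exists>y. E x y" if "x \<in> mspace U" for x
    using partial_isometry_limit_point[OF V R dense_U[OF that] that] that by (auto simp: E_def)
  have right: "\<exists>x. E x y" if y: "y \<in> mspace V" for y
  proof -
    have "\<exists>b\<in>Domain (R\<inverse>). mdist V y b < \<epsilon>" if "\<epsilon> > 0" for \<epsilon>
      using dense_V[OF y that] by simp
    from partial_isometry_limit_point[OF U partial_isometry_converse[OF R] this y]
    show ?thesis using y by (force simp: E_def)
  qed
  have E_dist: "mdist V y y' = mdist U x x'" if E: "E x y" "E x' y'" for x y x' y'
  proof -
    \<comment> \<open>One pair near \<open>x\<close> suffices: replacing \<open>x\<close> by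
      \<open>a\<close> and \<open>y\<close> by \<open>b\<close> changes each distance by less than
      \<open>\<epsilon> / 2\<close> and makes the two equal.\<close>
    have "\<bar>mdist V y y' - mdist U x x'\<bar> \<le> 0 + \<epsilon>" if "\<epsilon> > 0" for \<epsilon>
    proof -
      obtain a b where ab: "(a, b) \<in> R" "mdist U x a < \<epsilon> / 2"
        using dense_U[of x "\<epsilon> / 2"] E \<open>\<epsilon> > 0\<close> by (auto simp: E_def)
      note D = partial_isometryD[OF R ab(1)]
      have "mdist V y b = mdist U x a" "mdist V y' b = mdist U x' a"
        using E ab by (auto simp: E_def)
      moreover have "\<bar>mdist V y y' - mdist V b y'\<bar> \<le> mdist V y b"
        "\<bar>mdist U x x' - mdist U a x'\<bar> \<le> mdist U x a"
        using E D by (auto simp: E_def intro!: abs_mdist_diff_le)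
      ultimately show ?thesis using ab(2) by (simp add: mdist_commute[of _ _ y'] mdist_commute[of _ _ x'])
    qed
    then have "\<bar>mdist V y y' - mdist U x x'\<bar> \<le> 0" by (rule field_le_epsilon)
    then show ?thesis by simp
  qed
  define f where "f x = (SOME y. E x y)" for x
  have f: "E x (f x)" if "x \<in> mspace U" for x
    unfolding f_def using left[OF that] by (rule someI_ex)
  have "isometric_embedding U V f"
    unfolding isometric_embedding_def
  proof (intro conjI ballI image_subsetI)
    show "f x \<in> mspace V" if "x \<in> mspace U" for x using f[OF that] by (simp add: E_def)
    show "mdist V (f x) (f x') = mdist U x x'" if "x \<in> mspace U" "x' \<in> mspace U" for x x'
      by (rule E_dist[OF f[OF that(1)] f[OF that(2)]])
  qed
  moreover have "y \<in> f ` mspace U" if y: "y \<in> mspace V" for y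
  proof -
    obtain x where x: "E x y" using right[OF y] by blast
    then have xU: "x \<in> mspace U" by (simp add: E_def)
    \<comment> \<open>Both \<open>f x\<close> and \<open>y\<close> correspond to \<open>x\<close>,
      so they coincide.\<close>
    have "mdist V (f x) y = mdist U x x" using E_dist[OF f[OF xU] x] .
    then have "f x = y" using f[OF xU] y xU by (simp add: E_def)
    with xU show ?thesis by blast
  qed
  ultimately show ?thesis
    unfolding isometric_def isometric_embedding_def by blast
qed

text \<open>Stage \<open>n\<close> of the back-and-forth finds a partner for \<open>u n\<close> and
  one for \<open>v n\<close>, so the union of the stages has dense domain and dense range.\<close>

lemma one_point_injective_isometric:
  fixes U :: "'a metric" and V :: "'b metric"
  assumes U: "one_point_injective U" "mcomplete_of U" "separable_space (mtopology_of U)"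
    and V: "one_point_injective V" "mcomplete_of V" "separable_space (mtopology_of V)"
  shows "isometric U V"
proof -
  obtain u :: "nat \<Rightarrow> 'a" where u: "\<And>n. u n \<in> mspace U"
    "\<And>x \<epsilon>. x \<in> mspace U \<Longrightarrow> \<epsilon> > 0 \<Longrightarrow> \<exists>n. mdist U x (u n) < \<epsilon>"
    using separable_metric_dense_sequence[OF U(3) one_point_injective_nonempty[OF U(1)]] by blast
  obtain v :: "nat \<Rightarrow> 'b" where v: "\<And>n. v n \<in> mspace V"
    "\<And>x \<epsilon>. x \<in> mspace V \<Longrightarrow> \<epsilon> > 0 \<Longrightarrow> \<exists>n. mdist V x (v n) < \<epsilon>"
    using separable_metric_dense_sequence[OF V(3) one_point_injective_nonempty[OF V(1)]] by blast
  define good where "good P \<longleftrightarrow> finite P \<and> partial_isometry U V P" for P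
  have "\<exists>P. \<forall>n. good (P n) \<and> (P n \<subseteq> P (Suc n) \<and> u n \<in> Domain (P (Suc n)) \<and> v n \<in> Range (P (Suc n)))"
  proof (rule dependent_nat_choice)
    show "\<exists>P. good P" by (auto simp: good_def partial_isometry_def intro!: exI[of _ "{}"])
  next
    fix P and n :: nat assume P: "good P"
    obtain b where b: "partial_isometry U V (insert (u n, b) P)"
      using partial_isometry_extend[OF V(1) _ _ u(1)] P by (auto simp: good_def)
    have fin: "finite ((insert (u n, b) P)\<inverse>)" using P by (simp add: good_def)
    \<comment> \<open>The back half is the forth half for the converse relation.\<close>
    obtain a where a: "partial_isometry V U (insert (v n, a) ((insert (u n, b) P)\<inverse>))"
      using partial_isometry_extend[OF U(1) partial_isometry_converse[OF b] fin v(1)] by blast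
    have converse: "(insert (v n, a) ((insert (u n, b) P)\<inverse>))\<inverse> = insert (a, v n) (insert (u n, b) P)"
      by auto
    have "partial_isometry U V (insert (a, v n) (insert (u n, b) P))"
      using partial_isometry_converse[OF a] converse by simp
    then show "\<exists>Q. good Q \<and> (P \<subseteq> Q \<and> u n \<in> Domain Q \<and> v n \<in> Range Q)"
      using P by (intro exI[of _ "insert (a, v n) (insert (u n, b) P)"]) (auto simp: good_def)
  qed
  then obtain P where P: "\<And>n. partial_isometry U V (P n)" "\<And>n. P n \<subseteq> P (Suc n)"
    "\<And>n. u n \<in> Domain (P (Suc n))" "\<And>n. v n \<in> Range (P (Suc n))"
    unfolding good_def by blast
  define R where "R = (\<Union>n. P n)"
  \<comment> \<open>Distance preservation concerns two pairs at a time, so it passes to the union of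
    the increasing stages.\<close>
  have common: "\<exists>n. p \<in> P n \<and> q \<in> P n" if "p \<in> R" "q \<in> R" for p q
  proof -
    obtain m n where mn: "p \<in> P m" "q \<in> P n" using \<open>p \<in> R\<close> \<open>q \<in> R\<close> by (auto simp: R_def)
    have "P m \<subseteq> P (max m n)" "P n \<subseteq> P (max m n)"
      by (simp_all add: lift_Suc_mono_le[of P, OF P(2)])
    with mn show ?thesis by blast
  qed
  have R: "partial_isometry U V R"
    unfolding partial_isometry_def
  proof (intro conjI allI impI)
    show "R \<subseteq> mspace U \<times> mspace V" using P(1) by (auto simp: R_def partial_isometry_def)
    fix x y x' y' assume "(x, y) \<in> R \<and> (x', y') \<in> R"
    then obtain n where "(x, y) \<in> P n" "(x', y') \<in> P n" using common by blast
    then show "mdist V y y' = mdist U x x'" using partial_isometryD(3)[OF P(1)] by blast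
  qed
  have DR: "u n \<in> Domain R" "v n \<in> Range R" for n
    using P(3,4)[of n] by (auto simp: R_def)
  show ?thesis
  proof (rule dense_partial_isometry_imp_isometric[OF U(2) V(2) R])
    show "\<exists>a\<in>Domain R. mdist U x a < \<epsilon>" if "x \<in> mspace U" "\<epsilon> > 0" for x \<epsilon>
      using u(2)[OF that] DR(1) by blast
    show "\<exists>b\<in>Range R. mdist V y b < \<epsilon>" if "y \<in> mspace V" "\<epsilon> > 0" for y \<epsilon>
      using v(2)[OF that] DR(2) by blast
  qed
qed

section \<open>The points far from \<open>X\<close>\<close>

text \<open>The bound survives limits, so the set is closed in a complete space.\<close>

lemma mcomplete_of_far_from:
  assumes U: "mcomplete_of U" and X: "X \<subseteq> mspace U"
  shows "mcomplete_of (submetric U {z \<in> mspace U. \<forall>x\<in>X. M \<le> mdist U z x})"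
proof -
  interpret Metric_space "mspace U" "mdist U" by (rule Metric_space_mspace_mdist)
  let ?Y = "{z \<in> mspace U. \<forall>x\<in>X. M \<le> mdist U z x}"
  interpret Y: Submetric "mspace U" "mdist U" ?Y by unfold_locales auto
  have "closedin mtopology ?Y"
    unfolding metric_closedin_iff_sequentially_closed
  proof (intro conjI allI impI)
    fix \<sigma> l assume "range \<sigma> \<subseteq> ?Y \<and> limitin mtopology \<sigma> l sequentially"
    then have \<sigma>: "\<And>n. \<sigma> n \<in> ?Y" and l: "l \<in> mspace U" "(\<lambda>n. mdist U (\<sigma> n) l) \<longlonglongrightarrow> 0"
      by (auto simp: limitin_metric_dist_null)
    have "M \<le> mdist U l x" if x: "x \<in> X" for x
    proof (rule LIMSEQ_le_const2)
      have "M \<le> mdist U (\<sigma> n) l + mdist U l x" for n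
        using \<sigma>[of n] l(1) x X mdist_triangle[of "\<sigma> n" U l x] by force
      then show "\<exists>N. \<forall>n\<ge>N. M - mdist U (\<sigma> n) l \<le> mdist U l x"
        by (auto simp: algebra_simps)
      show "(\<lambda>n. M - mdist U (\<sigma> n) l) \<longlonglongrightarrow> M"
        using tendsto_diff[OF tendsto_const l(2), of M] by simp
    qed
    with l show "l \<in> ?Y" by simp
  qed auto
  then have "Y.sub.mcomplete"
    using U Y.closedin_mcomplete_imp_mcomplete by (simp add: mcomplete_of_def)
  moreover have "mspace (submetric U ?Y) = ?Y" by auto
  ultimately show ?thesis by (simp only: mcomplete_of_def mdist_submetric)
qed

lemma one_point_injective_far_from:
  assumes U: "one_point_injective U" "mcomplete_of U"
    and X: "X \<subseteq> mspace U" and hb: "heine_borel_space (submetric U X)" and M: "0 < M"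
  shows "one_point_injective (submetric U {z \<in> mspace U. \<forall>x\<in>X. M \<le> mdist U z x})"
    (is "one_point_injective (submetric U ?Y)")
  unfolding one_point_injective_def
proof (intro allI impI, elim conjE)
  fix F f assume F: "finite F" "F \<subseteq> mspace (submetric U ?Y)"
    and "katetov_on (submetric U ?Y) F f"
  then have f: "katetov_on U F f" by (simp add: katetov_on_def)
  note avoid = one_point_injective_avoiding[OF U X hb]
  show "\<exists>z\<in>mspace (submetric U ?Y). \<forall>x\<in>F. mdist (submetric U ?Y) z x = f x"
  proof (cases "F = {}")
    case False
    \<comment> \<open>Here \<open>y\<close> is itself at distance at least \<open>M\<close> from
      \<open>x\<close>, and \<open>f y\<close> is nonnegative.\<close>
    have "M \<le> f y + mdist U y x" if "x \<in> X" "y \<in> F" for x y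
      using katetov_on_nonneg[OF f \<open>y \<in> F\<close>] F(2) that by force
    then obtain z where "z \<in> mspace U" "\<forall>y\<in>F. mdist U z y = f y" "\<forall>x\<in>X. M \<le> mdist U z x"
      using avoid[OF F(1) False _ f, of M] F(2) by auto
    then show ?thesis by auto
  next
    case True
    show ?thesis
    proof (cases "X = {}")
      case True
      then show ?thesis using one_point_injective_nonempty[OF U(1)] \<open>F = {}\<close> by auto
    next
      case False
      then obtain x0 where x0: "x0 \<in> X" by blast
      \<comment> \<open>With nothing prescribed, a far point must still be found. The constant
        \<open>M\<close> on \<open>{x0}\<close> can be realized away from \<open>X\<close>, as
        \<open>M \<le> M + mdist U x0 x\<close>.\<close>
      have "katetov_on U {x0} (\<lambda>_. M)" using M X x0 by (auto simp: katetov_on_def subset_iff)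
      then obtain z where "z \<in> mspace U" "\<forall>x\<in>X. M \<le> mdist U z x"
        using avoid[of "{x0}" "\<lambda>_. M" M] X x0 by auto
      then show ?thesis using \<open>F = {}\<close> by auto
    qed
  qed
qed

theorem theorem3p4:
  fixes U :: "'a metric" and X :: "'a set" and M :: real
  assumes "urysohn_space U"
    and "X \<subseteq> mspace U"
    and "closedin (mtopology_of U) X"
    and "heine_borel_space (submetric U X)"
    and "M > 0"
  shows "isometric (submetric U {z \<in> mspace U. dist_to_set U z X \<ge> ereal M}) U"
proof -
  have U: "one_point_injective U" "mcomplete_of U" "separable_space (mtopology_of U)"
    using assms(1) finitely_injective_imp_one_point_injective by (auto simp: urysohn_space_def)
  \<comment> \<open>For \<open>X = {}\<close> the infimum is infinite, and both sets are the whole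
    space.\<close>
  have "{z \<in> mspace U. dist_to_set U z X \<ge> ereal M} = {z \<in> mspace U. \<forall>x\<in>X. M \<le> mdist U z x}"
    by (auto simp: dist_to_set_def le_INF_iff)
  then show ?thesis
    using one_point_injective_isometric[OF one_point_injective_far_from[OF U(1,2) assms(2,4,5)]
        mcomplete_of_far_from[OF U(2) assms(2)] separable_space_submetric[OF U(3)] U] by simp
qed

end
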